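(* Let $d\ge1$, $\Psi\in\mathcal B_0$, $V\in L^\infty(\mathbb R^d)$, let $\mathcal D\subset\mathbb R^d$ be a bounded convex open set, and let $\varphi$ be a non-zero solution of $$(\Psi(-\Delta)+V)\varphi=\lambda\varphi \ \text{ in } \mathcal D,\qquad \varphi=0 \ \text{ in } \mathcal D^c,$$ with eigenvalue $\lambda>0$. Suppose $|\varphi|$ attains its global maximum at $x^*\in\mathcal D$. Then $$\int_0^\infty\mathbb E^{x^*}\Big[e^{-\int_0^tV(X_s)\,ds}\,\mathbf 1_{\{\tau_{\mathcal D}>t\}}\Big]\,dt\ \ge\ \frac1\lambda .$$
   Context: $\mathcal B_0$ is the set of Bernstein functions vanishing at zero: $f\in C^\infty((0,\infty))$, $f\ge0$, $(-1)^n f^{(n)}\le 0$ for all $n\ge1$, and $\lim_{u\downarrow0}f(u)=0$. $\Psi(-\Delta)$ is the operator with Fourier multiplier $\Psi(|y|^2)$. Let $(S^\Psi_t)_{t\ge0}$ be the subordinator with $\mathbb E[e^{-uS^\Psi_t}]=e^{-t\Psi(u)}$, $(B_t)_{t\ge0}$ an independent $d$-dimensional Brownian motion running twice as fast as standard Brownian motion, and $X_t=B_{S^\Psi_t}$; $\mathbb E^x$ is expectation for $X$ started at $x$, and $\tau_{\mathcal D}=\inf\{t>0: X_t\notin\mathcal D\}$. Set $T^{\mathcal D,V}_tf(x)=\mathbb E^x\big[e^{-\int_0^tV(X_s)ds}f(X_t)\mathbf 1_{\{\tau_{\mathcal D}>t\}}\big]$, $x\in\mathcal D$; this semigroup has generator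 $-H^{\mathcal D,V}$, where $H^{\mathcal D,V}$ is the Friedrichs extension of $(\Psi(-\Delta)+V)|_{C_c^\infty(\mathcal D)}$. A non-zero solution $\varphi$ with eigenvalue $\lambda$ is a non-zero $\varphi\in L^2(\mathcal D)$ (extended by $0$ outside $\mathcal D$) with $H^{\mathcal D,V}\varphi=\lambda\varphi$, i.e. $T^{\mathcal D,V}_t\varphi=e^{-\lambda t}\varphi$ for all $t>0$, taken in the version for which this identity holds at every $x\in\mathcal D$. *)

theory Defs
  imports "HOL-Probability.Probability"
begin

section \<open>Bernstein functions vanishing at zero\<close>

text \<open>Only the values on the open half-line matter. Smoothness there makes the iterated
  \<^const>\<open>deriv\<close> the true derivatives.\<close>

definition bernstein0 :: "(real \<Rightarrow> real) \<Rightarrow> bool" where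
  "bernstein0 \<Psi> \<longleftrightarrow>
     (\<forall>n. \<forall>u>0. (deriv ^^ n) \<Psi> differentiable (at u)) \<and>
     (\<forall>u>0. \<Psi> u \<ge> 0) \<and>
     (\<forall>n\<ge>1. \<forall>u>0. (- 1) ^ n * (deriv ^^ n) \<Psi> u \<le> 0) \<and>
     (\<Psi> \<longlongrightarrow> 0) (at_right 0)"

section \<open>Subordinate Brownian motion\<close>

text \<open>Processes have time set \<open>{0..}\<close>; their values at negative times are irrelevant.\<close>

definition independent_increments ::
    "'w measure \<Rightarrow> (real \<Rightarrow> 'w \<Rightarrow> 'b::euclidean_space) \<Rightarrow> bool" where
  "independent_increments M Z \<longleftrightarrow>
     (\<forall>(t :: nat \<Rightarrow> real) n. 0 \<le> t 0 \<and> mono t \<longrightarrow>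
        prob_space.indep_vars M (\<lambda>_. borel) (\<lambda>i \<omega>. Z (t (Suc i)) \<omega> - Z (t i) \<omega>) {..<n})"

definition subordinator ::
    "'w measure \<Rightarrow> (real \<Rightarrow> real) \<Rightarrow> (real \<Rightarrow> 'w \<Rightarrow> real) \<Rightarrow> bool" where
  "subordinator M \<Psi> S \<longleftrightarrow>
     (\<forall>t\<ge>0. S t \<in> borel_measurable M) \<and>
     (AE \<omega> in M. S 0 \<omega> = 0 \<and> mono_on {0..} (\<lambda>t. S t \<omega>) \<and>
        (\<forall>t\<ge>0. continuous (at_right t) (\<lambda>s. S s \<omega>))) \<and>
     independent_increments M S \<and>
     (\<forall>s\<ge>0. \<forall>t\<ge>0. distr M borel (\<lambda>\<omega>. S (s + t) \<omega> - S s \<omega>) = distr M borel (S t)) \<and>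
     (\<forall>t\<ge>0. \<forall>u>0. (LINT \<omega>|M. exp (- u * S t \<omega>)) = exp (- t * \<Psi> u))"

text \<open>Running twice as fast as standard Brownian motion means that increments over \<open>[s, t]\<close>
  have covariance \<open>2 (t - s) I\<close>, so that the generator is the Laplacian. The second argument of
  \<^const>\<open>normal_density\<close> is the standard deviation.\<close>

definition double_speed_brownian_motion ::
    "'w measure \<Rightarrow> (real \<Rightarrow> 'w \<Rightarrow> real ^ 'n) \<Rightarrow> bool" where
  "double_speed_brownian_motion M B \<longleftrightarrow>
     (\<forall>t\<ge>0. B t \<in> borel_measurable M) \<and>
     (AE \<omega> in M. B 0 \<omega> = 0 \<and> continuous_on {0..} (\<lambda>t. B t \<omega>)) \<and>
     independent_increments M B \<and>
     (\<forall>s\<ge>0. \<forall>t>s. distributed M lborel (\<lambda>\<omega>. B t \<omega> - B s \<omega>)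
        (\<lambda>x. ennreal (\<Prod>i\<in>UNIV. normal_density 0 (sqrt (2 * (t - s))) (x $ i))))"

text \<open>\<^const>\<open>prob_space.indep_var\<close> needs both variables to have the same type, so independence is
  expressed through the generated sigma-algebras.\<close>

definition generated_events ::
    "'w measure \<Rightarrow> (real \<Rightarrow> 'w \<Rightarrow> 'b::euclidean_space) \<Rightarrow> 'w set set" where
  "generated_events M Z =
     sets (vimage_algebra (space M) (\<lambda>\<omega>. \<lambda>t\<in>{0..}. Z t \<omega>) (Pi\<^sub>M {0..} (\<lambda>_. borel)))"

definition independent_processes ::
    "'w measure \<Rightarrow> (real \<Rightarrow> 'w \<Rightarrow> 'b::euclidean_space) \<Rightarrow>
      (real \<Rightarrow> 'w \<Rightarrow> 'c::euclidean_space) \<Rightarrow> bool" where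
  "independent_processes M Y Z \<longleftrightarrow>
     prob_space.indep_set M (generated_events M Y) (generated_events M Z)"

text \<open>\<open>subordinate_bm S B x\<close> is the process under \<open>P\<^sup>x\<close>: spatial homogeneity lets all starting
  points share one probability space.\<close>

definition subordinate_bm ::
    "(real \<Rightarrow> 'w \<Rightarrow> real) \<Rightarrow> (real \<Rightarrow> 'w \<Rightarrow> real ^ 'n) \<Rightarrow> real ^ 'n \<Rightarrow> real \<Rightarrow> 'w \<Rightarrow> real ^ 'n" where
  "subordinate_bm S B x t \<omega> = x + B (S t \<omega>) \<omega>"

section \<open>The killed Feynman--Kac semigroup\<close>

definition exit_time :: "(real ^ 'n) set \<Rightarrow> (real \<Rightarrow> real ^ 'n) \<Rightarrow> ereal" where
  "exit_time D p = Inf {ereal t | t. 0 < t \<and> p t \<notin> D}"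

definition killed_weight ::
    "(real ^ 'n) set \<Rightarrow> (real ^ 'n \<Rightarrow> real) \<Rightarrow> (real \<Rightarrow> real ^ 'n) \<Rightarrow> real \<Rightarrow> real" where
  "killed_weight D V p t =
     exp (- (LINT s:{0..t}|lebesgue. V (p s))) * (if ereal t < exit_time D p then 1 else 0)"

text \<open>Expectations are taken over the completion of \<open>M\<close>, because events determined by an exit time
  are in general measurable only up to null sets.\<close>

definition feynman_kac ::
    "'w measure \<Rightarrow> (real ^ 'n \<Rightarrow> real \<Rightarrow> 'w \<Rightarrow> real ^ 'n) \<Rightarrow> (real ^ 'n) set \<Rightarrow> (real ^ 'n \<Rightarrow> real) \<Rightarrow>
      real \<Rightarrow> (real ^ 'n \<Rightarrow> complex) \<Rightarrow> real ^ 'n \<Rightarrow> complex" where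
  "feynman_kac M X D V t f x =
     (LINT \<omega>|completion M.
        complex_of_real (killed_weight D V (\<lambda>s. X x s \<omega>) t) * f (X x t \<omega>))"

text \<open>Valued in \<^typ>\<open>ennreal\<close> so that a possibly divergent time integral of it makes sense.\<close>

definition expected_killed_weight ::
    "'w measure \<Rightarrow> (real ^ 'n \<Rightarrow> real \<Rightarrow> 'w \<Rightarrow> real ^ 'n) \<Rightarrow> (real ^ 'n) set \<Rightarrow> (real ^ 'n \<Rightarrow> real) \<Rightarrow>
      real ^ 'n \<Rightarrow> real \<Rightarrow> ennreal" where
  "expected_killed_weight M X D V x t =
     (\<integral>\<^sup>+ \<omega>. ennreal (killed_weight D V (\<lambda>s. X x s \<omega>) t) \<partial>completion M)"

section \<open>The non-local Schroedinger operator\<close>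

definition essentially_bounded :: "(real ^ 'n \<Rightarrow> real) \<Rightarrow> bool" where
  "essentially_bounded V \<longleftrightarrow>
     V \<in> borel_measurable lebesgue \<and> (\<exists>C. AE x in lebesgue. \<bar>V x\<bar> \<le> C)"

definition L2_on :: "(real ^ 'n) set \<Rightarrow> (real ^ 'n \<Rightarrow> complex) \<Rightarrow> bool" where
  "L2_on D f \<longleftrightarrow> set_borel_measurable lebesgue D f \<and>
     set_integrable lebesgue D (\<lambda>x. (norm (f x))\<^sup>2)"

definition L2_inner ::
    "(real ^ 'n) set \<Rightarrow> (real ^ 'n \<Rightarrow> complex) \<Rightarrow> (real ^ 'n \<Rightarrow> complex) \<Rightarrow> complex" where
  "L2_inner D f g = (LINT x:D|lebesgue. f x * cnj (g x))"

definition partial_deriv :: "'n \<Rightarrow> (real ^ 'n \<Rightarrow> complex) \<Rightarrow> real ^ 'n \<Rightarrow> complex" where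
  "partial_deriv i f x = frechet_derivative f (at x) (axis i 1)"

definition test_functions :: "(real ^ 'n) set \<Rightarrow> (real ^ 'n \<Rightarrow> complex) set" where
  "test_functions D =
     {f. (\<forall>is. \<forall>x. foldr partial_deriv is f differentiable (at x)) \<and>
         (\<exists>K. compact K \<and> K \<subseteq> D \<and> (\<forall>x. x \<notin> K \<longrightarrow> f x = 0))}"

definition fourier :: "(real ^ 'n \<Rightarrow> complex) \<Rightarrow> real ^ 'n \<Rightarrow> complex" where
  "fourier f y = (LINT x|lebesgue. cis (- (x \<bullet> y)) * f x)"

text \<open>The multiplier operator with symbol \<open>\<Psi>(|y|\<^sup>2)\<close>, used on test functions only, where the
  inversion integral converges absolutely (\<open>\<Psi>\<close> grows at most linearly).\<close>

definition psi_laplacian ::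
    "(real \<Rightarrow> real) \<Rightarrow> (real ^ 'n \<Rightarrow> complex) \<Rightarrow> real ^ 'n \<Rightarrow> complex" where
  "psi_laplacian \<Psi> f x =
     (LINT y|lebesgue. cis (x \<bullet> y) * complex_of_real (\<Psi> ((norm y)\<^sup>2)) * fourier f y)
       / complex_of_real ((2 * pi) ^ CARD('n))"

definition schroedinger_op ::
    "(real \<Rightarrow> real) \<Rightarrow> (real ^ 'n \<Rightarrow> real) \<Rightarrow> (real ^ 'n \<Rightarrow> complex) \<Rightarrow> real ^ 'n \<Rightarrow> complex" where
  "schroedinger_op \<Psi> V f x = psi_laplacian \<Psi> f x + complex_of_real (V x) * f x"

text \<open>For \<open>A\<close> symmetric and bounded below on the dense subspace \<open>C\<close> of \<open>L\<^sup>2(D)\<close>,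
  \<open>friedrichs_extension D C A u w\<close> says that \<open>u\<close> lies in the domain of the Friedrichs extension
  of \<open>A|C\<close>, which maps it to \<open>w\<close>: the extension is the restriction of the adjoint of \<open>A|C\<close> to the
  closure of \<open>C\<close> in the form norm.\<close>

definition friedrichs_extension ::
    "(real ^ 'n) set \<Rightarrow> (real ^ 'n \<Rightarrow> complex) set \<Rightarrow>
      ((real ^ 'n \<Rightarrow> complex) \<Rightarrow> real ^ 'n \<Rightarrow> complex) \<Rightarrow>
      (real ^ 'n \<Rightarrow> complex) \<Rightarrow> (real ^ 'n \<Rightarrow> complex) \<Rightarrow> bool" where
  "friedrichs_extension D C A u w \<longleftrightarrow>
     L2_on D u \<and> L2_on D w \<and>
     (\<forall>g\<in>C. L2_inner D u (A g) = L2_inner D w g) \<and>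
     (\<exists>f :: nat \<Rightarrow> real ^ 'n \<Rightarrow> complex.
        (\<forall>n. f n \<in> C) \<and>
        ((\<lambda>n. LINT x:D|lebesgue. (norm (f n x - u x))\<^sup>2) \<longlonglongrightarrow> 0) \<and>
        (\<forall>e>0. \<exists>N. \<forall>m\<ge>N. \<forall>n\<ge>N.
           norm (L2_inner D (A (\<lambda>x. f m x - f n x)) (\<lambda>x. f m x - f n x)) < e))"

text \<open>A non-zero eigenfunction, extended by zero outside \<open>D\<close>, in the version for which the
  semigroup form of the eigenvalue equation holds at every point of \<open>D\<close>.\<close>

definition nonzero_solution ::
    "'w measure \<Rightarrow> (real \<Rightarrow> 'w \<Rightarrow> real) \<Rightarrow> (real \<Rightarrow> 'w \<Rightarrow> real ^ 'n) \<Rightarrow> (real \<Rightarrow> real) \<Rightarrow>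
      (real ^ 'n \<Rightarrow> real) \<Rightarrow> (real ^ 'n) set \<Rightarrow> real \<Rightarrow> (real ^ 'n \<Rightarrow> complex) \<Rightarrow> bool" where
  "nonzero_solution M S B \<Psi> V D lam \<phi> \<longleftrightarrow>
     L2_on D \<phi> \<and>
     (\<forall>x. x \<notin> D \<longrightarrow> \<phi> x = 0) \<and>
     \<not> (AE x in lebesgue. \<phi> x = 0) \<and>
     friedrichs_extension D (test_functions D) (schroedinger_op \<Psi> V)
       \<phi> (\<lambda>x. complex_of_real lam * \<phi> x) \<and>
     (\<forall>t>0. \<forall>x\<in>D. feynman_kac M (subordinate_bm S B) D V t \<phi> x
        = complex_of_real (exp (- lam * t)) * \<phi> x)"

end

theory Submission
  imports Defs "HOL-Real_Asymp.Real_Asymp"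
begin

text \<open>Evaluate the semigroup form of the eigenvalue equation at the maximum point. There
  exp(-lam t) |\<phi>(xstar)| is the modulus of the expectation of the weight times \<phi>(X_t),
  hence at most |\<phi>(xstar)| times the expected weight
  (\<open>expected_killed_weight_ge\<close>). Since \<phi> is non-zero, so is \<phi>(xstar);
  cancelling it bounds the expected weight below by exp(-lam t) for every t > 0. Integrating over t
  gives 1/lam (\<open>nn_integral_exp_neg_atLeast_0\<close>).\<close>

lemma expected_killed_weight_ge:
  assumes bound: "\<And>y. norm (f y) \<le> c" and "c > 0"
    and nz: "feynman_kac M X D V t f x \<noteq> 0"
  shows "ennreal (norm (feynman_kac M X D V t f x) / c) \<le> expected_killed_weight M X D V x t"
proof -
  let ?k = "\<lambda>\<omega>. killed_weight D V (\<lambda>s. X x s \<omega>) t"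
  let ?g = "\<lambda>\<omega>. complex_of_real (?k \<omega>) * f (X x t \<omega>)"
  \<comment> \<open>A Bochner integral takes the default value 0 when the integrand is not
    integrable, so the non-zero value assumed in \<open>nz\<close> already forces
    integrability.\<close>
  have int: "integrable (completion M) ?g"
    using nz not_integrable_integral_eq unfolding feynman_kac_def by blast
  have k_nonneg: "?k \<omega> \<ge> 0" for \<omega>
    by (simp add: killed_weight_def)
  have "norm (feynman_kac M X D V t f x) / c = norm (LINT \<omega>|completion M. ?g \<omega> / of_real c)"
    using \<open>c > 0\<close> by (simp add: feynman_kac_def norm_divide)
  also have "ennreal \<dots> \<le> (\<integral>\<^sup>+ \<omega>. norm (?g \<omega> / of_real c) \<partial>completion M)"
    using int by (intro integral_norm_bound_ennreal integrable_divide)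
  \<comment> \<open>Dividing by \<open>c\<close> inside the integral avoids showing that \<^const>\<open>killed_weight\<close> is measurable.\<close>
  also have "\<dots> \<le> (\<integral>\<^sup>+ \<omega>. ennreal (?k \<omega>) \<partial>completion M)"
    using \<open>c > 0\<close> k_nonneg
    by (intro nn_integral_mono ennreal_leI)
       (simp add: norm_mult norm_divide divide_le_eq mult_left_mono bound)
  finally show ?thesis
    by (simp add: expected_killed_weight_def)
qed

lemma nn_integral_exp_neg_atLeast_0:
  fixes l :: real
  assumes "l > 0"
  shows "(\<integral>\<^sup>+ t\<in>{0..}. ennreal (exp (- l * t)) \<partial>lborel) = ennreal (1 / l)"
proof -
  have "((\<lambda>t. - exp (- l * t) / l) \<longlongrightarrow> 0) at_top"
    using assms by real_asymp
  then have "(\<integral>\<^sup>+ t\<in>{0..}. ennreal (exp (- l * t)) \<partial>lborel) = ennreal (0 - (- exp (- l * 0) / l))"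
    using assms by (intro nn_integral_FTC_atLeast) (auto intro!: derivative_eq_intros)
  then show ?thesis by simp
qed

theorem corollary3p2:
  fixes M :: "'w measure"
    and S :: "real \<Rightarrow> 'w \<Rightarrow> real"
    and B :: "real \<Rightarrow> 'w \<Rightarrow> real ^ 'n"
    and \<Psi> :: "real \<Rightarrow> real"
    and V :: "real ^ 'n \<Rightarrow> real"
    and D :: "(real ^ 'n) set"
    and \<phi> :: "real ^ 'n \<Rightarrow> complex"
    and lam :: real
    and xstar :: "real ^ 'n"
  assumes "prob_space M"
    and "bernstein0 \<Psi>"
    and "subordinator M \<Psi> S"
    and "double_speed_brownian_motion M B"
    and "independent_processes M S B"
    and "essentially_bounded V"
    and "bounded D" and "convex D" and "open D"
    and "lam > 0"
    and "nonzero_solution M S B \<Psi> V D lam \<phi>"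
    and "xstar \<in> D"
    and "\<forall>y. norm (\<phi> y) \<le> norm (\<phi> xstar)"
  shows "(\<integral>\<^sup>+ t\<in>{0..}. expected_killed_weight M (subordinate_bm S B) D V xstar t \<partial>lborel)
           \<ge> ennreal (1 / lam)"
proof -
  let ?E = "expected_killed_weight M (subordinate_bm S B) D V xstar"
  have nz: "\<not> (AE x in lebesgue. \<phi> x = 0)"
    and eig: "\<And>t. t > 0 \<Longrightarrow> feynman_kac M (subordinate_bm S B) D V t \<phi> xstar
        = complex_of_real (exp (- lam * t)) * \<phi> xstar"
    using assms(11,12) by (auto simp: nonzero_solution_def)
  have "\<phi> xstar \<noteq> 0"
  proof
    assume "\<phi> xstar = 0"
    then have "\<phi> = (\<lambda>_. 0)"
      using assms(13) by auto
    then show False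
      using nz by simp
  qed
  \<comment> \<open>With c = |\<phi>(xstar)|, the fact that \<phi>(xstar) is non-zero yields both c
    > 0 and, through the eigenvalue equation, the premise \<open>nz\<close>.\<close>
  have lower: "ennreal (exp (- lam * t)) \<le> ?E t" if "t > 0" for t
    using expected_killed_weight_ge[of \<phi> "norm (\<phi> xstar)" M "subordinate_bm S B" D V t xstar]
      eig[OF that] \<open>\<phi> xstar \<noteq> 0\<close> assms(13) by (simp add: norm_mult)
  have "ennreal (1 / lam) = (\<integral>\<^sup>+ t\<in>{0..}. ennreal (exp (- lam * t)) \<partial>lborel)"
    using nn_integral_exp_neg_atLeast_0[OF assms(10)] by simp
  also have "\<dots> \<le> (\<integral>\<^sup>+ t\<in>{0..}. ?E t \<partial>lborel)"
    \<comment> \<open>The bound \<open>lower\<close> is available only for t > 0; the remaining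
      point t = 0 is a null set. Monotonicity of \<open>nn_integral\<close> holds for arbitrary
      functions, so the measurability of \<open>?E\<close> in t does not arise.\<close>
    using AE_lborel_singleton[of "0::real"]
    by (intro nn_integral_mono_AE) (auto elim!: eventually_mono simp: indicator_def lower[simplified])
  finally show ?thesis .
qed

end
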